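(* The system of spectral derivative relations $$W\phi'_n=\Theta_n\phi_{n+1}-(\Omega_n+V)\phi_n,\qquad W\phi^{*\prime}_n=-\Theta^*_n\phi^*_{n+1}+(\Omega^*_n-V)\phi^*_n,$$ $$W\epsilon'_n=\Theta_n\epsilon_{n+1}-(\Omega_n-V)\epsilon_n,\qquad W\epsilon^{*\prime}_n=-\Theta^*_n\epsilon^*_{n+1}+(\Omega^*_n+V)\epsilon^*_n$$ is equivalent to the matrix differential equation $$Y'_n=A_nY_n,\qquad Y_n(z)=\begin{pmatrix}\phi_n(z)&\dfrac{\epsilon_n(z)}{w(z)}\\[4pt]\phi^*_n(z)&-\dfrac{\epsilon^*_n(z)}{w(z)}\end{pmatrix},$$ where $$A_n(z)=\frac{1}{W(z)}\begin{pmatrix}-\left[\Omega_n(z)+V(z)-\dfrac{\kappa_{n+1}}{\kappa_n}z\Theta_n(z)\right]&\dfrac{\phi_{n+1}(0)}{\kappa_n}\Theta_n(z)\\[6pt]-\dfrac{\bar\phi_{n+1}(0)}{\kappa_n}z\Theta^*_n(z)&\Omega^*_n(z)-V(z)-\dfrac{\kappa_{n+1}}{\kappa_n}\Theta^*_n(z)\end{pmatrix}.$$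
   Context: Let $\mathbb T=\{\zeta\in\mathbb C:|\zeta|=1\}$, $\zeta=e^{i\theta}$, $\theta\in(-\pi,\pi]$. The weight $w$ is a complex (not necessarily real or positive) function, analytic in a cut complex plane, with $z^jw,z^jw'\in L^1(\mathbb T)$ for all $j\in\mathbb Z$ and with expansion $w(z)=\sum_{k\in\mathbb Z}w_kz^k$, $w_k=\int_{\mathbb T}\frac{d\zeta}{2\pi i\zeta}w(\zeta)\zeta^{-k}$, converging in an annulus containing $\mathbb T$. Assume $\det[w_{j-k}]_{0\le j,k\le n-1}\ne0$ for all $n\ge1$. The bi-orthonormal polynomials are $\phi_n(z)=\kappa_nz^n+\dots+\phi_n(0)$ and $\bar\phi_n(z)=\kappa_nz^n+\dots+\bar\phi_n(0)$, of degree $n$ with the same leading coefficient $\kappa_n\ne0$, satisfying $\int_{\mathbb T}\frac{d\zeta}{2\pi i\zeta}w(\zeta)\phi_m(\zeta)\bar\phi_n(\bar\zeta)=\delta_{m,n}$ with $\bar\zeta=\zeta^{-1}$ on $\mathbb T$; the bar on $\bar\phi_n$ is notation and does not denote complex conjugation. The reciprocal polynomial is $\phi^*_n(z)=z^n\bar\phi_n(1/z)$. With $F(z)=\int_{\mathbb T}\frac{d\zeta}{2\pi i\zeta}\frac{\zeta+z}{\zeta-z}w(\zeta)$, the associated functions, defined for $z\notin\mathbb T$, are $\epsilon_n(z)=\int_{\mathbb T}\frac{d\zeta}{2\pi i\zeta}\frac{\zeta+z}{\zeta-z}w(\zeta)\phi_n(\zeta)$ and $\epsilon^*_n(z)=-z^n\int_{\mathbb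 T}\frac{d\zeta}{2\pi i\zeta}\frac{\zeta+z}{\zeta-z}w(\zeta)\bar\phi_n(\bar\zeta)$ for $n\ge1$, and $\epsilon_0=1/\kappa_0+\kappa_0F$, $\epsilon^*_0=1/\kappa_0-\kappa_0F$. $W(z)\not\equiv0$ and $V(z)$ are functions independent of $n$ with $Ww'=2Vw$; $\Theta_n,\Omega_n,\Theta^*_n,\Omega^*_n$ are functions of $z$ (the coefficient functions); $n\ge0$ and $'=d/dz$. *)

theory Defs
  imports "HOL-Complex_Analysis.Complex_Analysis" "Jordan_Normal_Form.Determinant"
begin

text \<open>\<open>circ_int f\<close> is the integral of \<open>f(\<zeta>)\<close> over the unit circle against
  \<open>d\<zeta> / (2 \<pi> i \<zeta>)\<close>.\<close>

definition circ_int :: "(complex \<Rightarrow> complex) \<Rightarrow> complex" where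
  "circ_int f = contour_integral (circlepath 0 1) (\<lambda>\<zeta>. f \<zeta> / (2 * of_real pi * \<i> * \<zeta>))"

definition L1_circle :: "(complex \<Rightarrow> complex) \<Rightarrow> bool" where
  "L1_circle f \<longleftrightarrow> (\<lambda>\<theta>. f (cis \<theta>)) absolutely_integrable_on {-pi..pi}"

definition fourier_coeff :: "(complex \<Rightarrow> complex) \<Rightarrow> int \<Rightarrow> complex" where
  "fourier_coeff w k = circ_int (\<lambda>\<zeta>. w \<zeta> * \<zeta> powi (- k))"

definition toeplitz_det :: "(complex \<Rightarrow> complex) \<Rightarrow> nat \<Rightarrow> complex" where
  "toeplitz_det w n = Determinant.det
     (Matrix.mat n n (\<lambda>(j, k). fourier_coeff w (int j - int k)))"

text \<open>\<open>w\<close> is analytic in the plane minus the cuts. The cuts (branch cuts together with branch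
  points and other singularities) are only required to form a closed set with empty interior;
  their shape is left arbitrary. The Laurent expansion represents \<open>w\<close> on an
  annulus containing the unit circle.\<close>

definition admissible_weight :: "complex set \<Rightarrow> (complex \<Rightarrow> complex) \<Rightarrow> bool" where
  "admissible_weight cuts w \<longleftrightarrow>
     closed cuts \<and> interior cuts = {} \<and> w holomorphic_on (- cuts) \<and>
     (\<forall>j::int. L1_circle (\<lambda>z. z powi j * w z) \<and> L1_circle (\<lambda>z. z powi j * deriv w z)) \<and>
     (\<exists>r R. 0 \<le> r \<and> r < 1 \<and> 1 < R \<and>
        (\<forall>z. r < norm z \<and> norm z < R \<longrightarrow>
           ((\<lambda>k::int. fourier_coeff w k * z powi k) has_sum w z) UNIV)) \<and>
     (\<forall>n\<ge>1. toeplitz_det w n \<noteq> 0)"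

text \<open>The family \<open>\<phi>b\<close> is the second system of polynomials (usually written with a
  bar); it is not the complex conjugate of \<open>\<phi>\<close>. On the circle the conjugate of \<open>\<zeta>\<close>
  is \<open>1 / \<zeta>\<close>.\<close>

definition biorthonormal ::
    "(complex \<Rightarrow> complex) \<Rightarrow> (nat \<Rightarrow> complex) \<Rightarrow> (nat \<Rightarrow> complex poly) \<Rightarrow>
     (nat \<Rightarrow> complex poly) \<Rightarrow> bool" where
  "biorthonormal w \<kappa> \<phi> \<phi>b \<longleftrightarrow>
     (\<forall>n. \<kappa> n \<noteq> 0 \<and>
          degree (\<phi> n) = n \<and> lead_coeff (\<phi> n) = \<kappa> n \<and>
          degree (\<phi>b n) = n \<and> lead_coeff (\<phi>b n) = \<kappa> n) \<and>
     (\<forall>m n. circ_int (\<lambda>\<zeta>. w \<zeta> * poly (\<phi> m) \<zeta> * poly (\<phi>b n) (1 / \<zeta>)) =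
              (if m = n then 1 else 0))"

text \<open>The reciprocal polynomial \<open>z\<^sup>n \<phi>b\<^sub>n(1/z)\<close>: \<open>reflect_poly\<close> uses the actual degree, which
  is \<open>n\<close> for \<open>\<phi>b n\<close>, and gives the polynomial value (the leading coefficient) at \<open>z = 0\<close>.\<close>

definition phi_star :: "(nat \<Rightarrow> complex poly) \<Rightarrow> nat \<Rightarrow> complex \<Rightarrow> complex" where
  "phi_star \<phi>b n z = poly (reflect_poly (\<phi>b n)) z"

definition carath :: "(complex \<Rightarrow> complex) \<Rightarrow> complex \<Rightarrow> complex" where
  "carath w z = circ_int (\<lambda>\<zeta>. (\<zeta> + z) / (\<zeta> - z) * w \<zeta>)"

text \<open>The associated functions are meaningful only for \<open>norm z \<noteq> 1\<close>.\<close>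

definition eps ::
    "(complex \<Rightarrow> complex) \<Rightarrow> (nat \<Rightarrow> complex) \<Rightarrow> (nat \<Rightarrow> complex poly) \<Rightarrow>
     nat \<Rightarrow> complex \<Rightarrow> complex" where
  "eps w \<kappa> \<phi> n z =
     (if n = 0 then 1 / \<kappa> 0 + \<kappa> 0 * carath w z
      else circ_int (\<lambda>\<zeta>. (\<zeta> + z) / (\<zeta> - z) * w \<zeta> * poly (\<phi> n) \<zeta>))"

definition eps_star ::
    "(complex \<Rightarrow> complex) \<Rightarrow> (nat \<Rightarrow> complex) \<Rightarrow> (nat \<Rightarrow> complex poly) \<Rightarrow>
     nat \<Rightarrow> complex \<Rightarrow> complex" where
  "eps_star w \<kappa> \<phi>b n z =
     (if n = 0 then 1 / \<kappa> 0 - \<kappa> 0 * carath w z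
      else - (z ^ n) * circ_int (\<lambda>\<zeta>. (\<zeta> + z) / (\<zeta> - z) * w \<zeta> * poly (\<phi>b n) (1 / \<zeta>)))"

definition Ymat ::
    "(complex \<Rightarrow> complex) \<Rightarrow> (nat \<Rightarrow> complex) \<Rightarrow> (nat \<Rightarrow> complex poly) \<Rightarrow>
     (nat \<Rightarrow> complex poly) \<Rightarrow> nat \<Rightarrow> complex \<Rightarrow> complex mat" where
  "Ymat w \<kappa> \<phi> \<phi>b n z = mat_of_rows_list 2
     [[poly (\<phi> n) z, eps w \<kappa> \<phi> n z / w z],
      [phi_star \<phi>b n z, - (eps_star w \<kappa> \<phi>b n z / w z)]]"

text \<open>The functions \<open>\<Theta>s\<close> and \<open>\<Omega>s\<close> are the starred coefficient functions.\<close>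

definition Amat ::
    "(nat \<Rightarrow> complex) \<Rightarrow> (nat \<Rightarrow> complex poly) \<Rightarrow> (nat \<Rightarrow> complex poly) \<Rightarrow>
     (complex \<Rightarrow> complex) \<Rightarrow> (complex \<Rightarrow> complex) \<Rightarrow>
     (nat \<Rightarrow> complex \<Rightarrow> complex) \<Rightarrow> (nat \<Rightarrow> complex \<Rightarrow> complex) \<Rightarrow>
     (nat \<Rightarrow> complex \<Rightarrow> complex) \<Rightarrow> (nat \<Rightarrow> complex \<Rightarrow> complex) \<Rightarrow>
     nat \<Rightarrow> complex \<Rightarrow> complex mat" where
  "Amat \<kappa> \<phi> \<phi>b W V \<Theta> \<Omega> \<Theta>s \<Omega>s n z = (1 / W z) \<cdot>\<^sub>m mat_of_rows_list 2
     [[- (\<Omega> n z + V z - \<kappa> (n + 1) / \<kappa> n * z * \<Theta> n z),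
       poly (\<phi> (n + 1)) 0 / \<kappa> n * \<Theta> n z],
      [- (poly (\<phi>b (n + 1)) 0 / \<kappa> n * z * \<Theta>s n z),
       \<Omega>s n z - V z - \<kappa> (n + 1) / \<kappa> n * \<Theta>s n z]]"

definition has_mat_derivative ::
    "(complex \<Rightarrow> complex mat) \<Rightarrow> complex mat \<Rightarrow> complex \<Rightarrow> bool" where
  "has_mat_derivative Y D z \<longleftrightarrow>
     dim_row (Y z) = dim_row D \<and> dim_col (Y z) = dim_col D \<and>
     (\<forall>i < dim_row D. \<forall>j < dim_col D.
        ((\<lambda>u. Y u $$ (i, j)) has_field_derivative D $$ (i, j)) (at z))"

end

theory Submission
  imports Defs
begin

text \<open>Multiplying out \<open>A\<^sub>n Y\<^sub>n\<close>, each entry contains the combination of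
  \<open>\<phi>\<^sub>n\<close> and \<open>\<phi>\<^sub>n\<^sup>*\<close> (first column) or of \<open>\<epsilon>\<^sub>n\<close> and
  \<open>\<epsilon>\<^sub>n\<^sup>*\<close> (second column) which by the Szego recurrences
    \<open>\<kappa>\<^sub>n \<phi>\<^sub>n\<^sub>+\<^sub>1 = \<kappa>\<^sub>n\<^sub>+\<^sub>1 z \<phi>\<^sub>n + \<phi>\<^sub>n\<^sub>+\<^sub>1(0) \<phi>\<^sub>n\<^sup>*\<close> and
    \<open>\<kappa>\<^sub>n \<epsilon>\<^sub>n\<^sub>+\<^sub>1 = \<kappa>\<^sub>n\<^sub>+\<^sub>1 z \<epsilon>\<^sub>n - \<phi>\<^sub>n\<^sub>+\<^sub>1(0) \<epsilon>\<^sub>n\<^sup>*\<close>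
  and their starred companions is the member of index \<open>n + 1\<close>. In the second column the
  division by \<open>w\<close> contributes \<open>- w'/w = - 2 V/W\<close> to the logarithmic derivative, and this is
  what changes the sign of \<open>V\<close> in the relations for \<open>\<epsilon>\<^sub>n\<close> and \<open>\<epsilon>\<^sub>n\<^sup>*\<close>. Hence
  the equivalence holds at each point and for each \<open>n\<close>, entry by entry; its substance lies in the
  four recurrences and in the differentiability of \<open>\<epsilon>\<^sub>n\<close> and \<open>\<epsilon>\<^sub>n\<^sup>*\<close> off the
  circle, without which an equation about \<open>deriv\<close> would not yield a derivative.

  The Laurent expansion converges absolutely on the circle, so \<open>w\<close> is continuous there and every
  integral that occurs off the circle has a continuous integrand. The polynomial recurrence
  (\<open>szego_recurrence\<close>) follows from bi-orthogonality: the difference of its two sides is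
  divisible by \<open>z\<close>, and the quotient is orthogonal to all polynomials up to its own degree. The
  recurrence for \<open>\<epsilon>\<^sub>n\<close> (\<open>eps_recurrence\<close>) follows by applying the kernel
  \<open>(\<zeta> + z)/(\<zeta> - z)\<close> to the polynomial one: the pole cancels and what is left are a few
  pairings of low degree.

  The substitution \<open>\<zeta> \<mapsto> 1/\<zeta>\<close> preserves the measure on the circle and exchanges the two
  polynomial systems. It expresses \<open>\<epsilon>\<^sub>n\<^sup>*(z)\<close> as \<open>z\<^sup>n\<close> times the value
  at \<open>1/z\<close> of the function \<open>\<epsilon>\<^sub>n\<close> of the inverted weight (\<open>eps_star_inversion\<close>), so that the two starred recurrences are the unstarred
  ones for the inverted weight.\<close>

section \<open>Integration over the unit circle\<close>

lemma circ_int_param: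
  "circ_int f = integral {0..1} (\<lambda>t. f (exp (2 * of_real pi * \<i> * of_real t)))"
  unfolding circ_int_def contour_integral_integral
  by (rule Henstock_Kurzweil_Integration.integral_cong)
     (simp add: vector_derivative_circlepath, simp add: circlepath)

lemma circ_int_cong:
  assumes "\<And>\<zeta>. norm \<zeta> = 1 \<Longrightarrow> f \<zeta> = g \<zeta>"
  shows "circ_int f = circ_int g"
  unfolding circ_int_param by (rule Henstock_Kurzweil_Integration.integral_cong) (simp add: assms)

lemma circle_param_integrable:
  fixes f :: "complex \<Rightarrow> complex"
  assumes "continuous_on (sphere 0 1) f"
  shows "(\<lambda>t::real. f (exp (2 * of_real pi * \<i> * of_real t))) integrable_on {0..1}"
  by (intro integrable_continuous_interval continuous_on_compose2[OF assms])
     (auto intro!: continuous_intros)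

lemma circ_int_add:
  assumes "continuous_on (sphere 0 1) f" "continuous_on (sphere 0 1) g"
  shows "circ_int (\<lambda>\<zeta>. f \<zeta> + g \<zeta>) = circ_int f + circ_int g"
  unfolding circ_int_param
  by (intro Henstock_Kurzweil_Integration.integral_add circle_param_integrable assms)

lemma circ_int_cmult: "circ_int (\<lambda>\<zeta>. c * f \<zeta>) = c * circ_int f"
  unfolding circ_int_param by simp

text \<open>The map \<open>\<zeta> \<mapsto> 1/\<zeta>\<close> reverses the angle \<open>2 \<pi> t\<close>, that is, it replaces
  \<open>t\<close> by \<open>1 - t\<close>. This symmetry halves the work below: each statement about one of the two
  polynomial systems gives the corresponding one about the other.\<close>

lemma circ_int_inversion:
  assumes "continuous_on (sphere 0 1) f"
  shows "circ_int (\<lambda>\<zeta>. f (1 / \<zeta>)) = circ_int f"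
proof -
  have "((\<lambda>t::real. f (exp (2 * of_real pi * \<i> * of_real t))) has_integral circ_int f) {0..1}"
    unfolding circ_int_param by (intro integrable_integral circle_param_integrable assms)
  from has_integral_affinity01[OF this, of "- 1" 1]
  have "((\<lambda>t::real. f (exp (2 * of_real pi * \<i> * of_real (1 - t)))) has_integral circ_int f) {0..1}"
    by (simp add: image_affinity_atLeastAtMost_diff image_def[symmetric] o_def)
  moreover have "exp (2 * of_real pi * \<i> * of_real (1 - t))
      = 1 / exp (2 * of_real pi * \<i> * of_real t)" for t :: real
    using exp_two_pi_i by (simp add: algebra_simps exp_diff)
  ultimately show ?thesis
    unfolding circ_int_param by (simp add: integral_unique)
qed

text \<open>Unconditional summability over the integers at \<open>z = 1\<close> is absolute summability of the
  coefficients, and these dominate the terms of the series on the whole circle.\<close>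

lemma laurent_weight_continuous_on_circle:
  assumes "r < 1" "1 < R"
    and "\<And>z. r < norm z \<Longrightarrow> norm z < R \<Longrightarrow> ((\<lambda>k::int. c k * z powi k) has_sum w z) UNIV"
  shows "continuous_on (sphere 0 1) (w :: complex \<Rightarrow> complex)"
proof -
  have "(\<lambda>k. c k * 1 powi k) summable_on UNIV"
    using assms(3)[of 1] assms(1,2) by (auto simp: summable_on_def)
  then have "(\<lambda>k. norm (c k)) summable_on UNIV"
    by (simp add: summable_on_iff_abs_summable_on_complex)
  then have "uniform_limit (sphere 0 1) (\<lambda>X z. \<Sum>k\<in>X. c k * z powi k) w
      (finite_subsets_at_top UNIV)"
    using assms by (intro Weierstrass_m_test_general') (auto simp: norm_mult norm_power_int)
  then show ?thesis
    by (rule uniform_limit_theorem[rotated])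
       (auto intro!: always_eventually continuous_intros)
qed

section \<open>The pairing defined by the weight\<close>

definition pairing :: "(complex \<Rightarrow> complex) \<Rightarrow> complex poly \<Rightarrow> complex poly \<Rightarrow> complex" where
  "pairing w p q = circ_int (\<lambda>\<zeta>. w \<zeta> * poly p \<zeta> * poly q (1 / \<zeta>))"

lemma pairing_swap:
  assumes "continuous_on (sphere 0 1) w"
  shows "pairing (\<lambda>\<zeta>. w (1 / \<zeta>)) q p = pairing w p q"
proof -
  have "continuous_on (sphere 0 1) (\<lambda>\<zeta>. w \<zeta> * poly p \<zeta> * poly q (1 / \<zeta>))"
    by (intro continuous_intros assms) auto
  from circ_int_inversion[OF this] show ?thesis
    unfolding pairing_def by (simp add: mult_ac)
qed

lemma inverted_weight_continuous:
  assumes "continuous_on (sphere 0 1) (w :: complex \<Rightarrow> complex)"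
  shows "continuous_on (sphere 0 1) (\<lambda>\<zeta>. w (1 / \<zeta>))"
  by (rule continuous_on_compose2[OF assms]) (auto intro!: continuous_intros simp: norm_divide)

lemma pairing_add_left:
  assumes "continuous_on (sphere 0 1) w"
  shows "pairing w (p + r) q = pairing w p q + pairing w r q"
  unfolding pairing_def
  by (subst circ_int_add[symmetric])
     (auto intro!: continuous_intros assms circ_int_cong simp: algebra_simps)

lemma pairing_smult_left: "pairing w (Polynomial.smult c p) q = c * pairing w p q"
  unfolding pairing_def circ_int_cmult[symmetric] by (simp add: mult_ac)

lemma pairing_pCons_pCons: "pairing w (pCons 0 p) (pCons 0 q) = pairing w p q"
  unfolding pairing_def by (rule circ_int_cong) (auto simp: field_simps)

text \<open>With \<open>m = degree p\<close>, the integrand contains \<open>\<zeta>\<^sup>m p(1/\<zeta>) q(1/\<zeta>)\<close>, in which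
  the power of \<open>\<zeta>\<close> can be given to \<open>q\<close> in place of \<open>p\<close>. It turns a pairing with a
  reciprocal polynomial on the left into one with a member of the second system on the right.\<close>

lemma pairing_reflect_left:
  assumes "degree q \<le> degree p"
  shows "pairing w (reflect_poly p) q = pairing w (monom 1 (degree p - degree q) * reflect_poly q) p"
  unfolding pairing_def
proof (rule circ_int_cong)
  fix \<zeta> :: complex assume "norm \<zeta> = 1"
  then have nz: "\<zeta> \<noteq> 0" by auto
  have "\<zeta> ^ degree p = \<zeta> ^ (degree p - degree q) * \<zeta> ^ degree q"
    using assms by (simp flip: power_add)
  then show "w \<zeta> * poly (reflect_poly p) \<zeta> * poly q (1 / \<zeta>) =
     w \<zeta> * poly (monom 1 (degree p - degree q) * reflect_poly q) \<zeta> * poly p (1 / \<zeta>)"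
    using nz by (simp add: poly_reflect_poly_nz poly_monom inverse_eq_divide)
qed

lemma biorthonormalD:
  assumes "biorthonormal w \<kappa> \<phi> \<phi>b"
  shows "\<kappa> n \<noteq> 0" "degree (\<phi> n) = n" "degree (\<phi>b n) = n"
    "coeff (\<phi> n) n = \<kappa> n" "coeff (\<phi>b n) n = \<kappa> n"
    "pairing w (\<phi> m) (\<phi>b n) = (if m = n then 1 else 0)"
proof -
  show d: "\<kappa> n \<noteq> 0" "degree (\<phi> n) = n" "degree (\<phi>b n) = n"
    "pairing w (\<phi> m) (\<phi>b n) = (if m = n then 1 else 0)"
    using assms unfolding biorthonormal_def pairing_def by blast+
  show "coeff (\<phi> n) n = \<kappa> n" "coeff (\<phi>b n) n = \<kappa> n"
    using assms d(2,3) unfolding biorthonormal_def by metis+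
qed

lemma biorthonormal_swap:
  assumes "continuous_on (sphere 0 1) w" "biorthonormal w \<kappa> \<phi> \<phi>b"
  shows "biorthonormal (\<lambda>\<zeta>. w (1 / \<zeta>)) \<kappa> \<phi>b \<phi>"
proof -
  have "pairing (\<lambda>\<zeta>. w (1 / \<zeta>)) (\<phi>b m) (\<phi> n) = (if m = n then 1 else 0)" for m n
    by (simp add: pairing_swap[OF assms(1)] biorthonormalD[OF assms(2)])
  then show ?thesis
    by (simp add: biorthonormal_def pairing_def biorthonormalD[OF assms(2)])
qed

text \<open>A polynomial of degree at most \<open>n\<close> is a combination of \<open>\<phi>\<^sub>0, \<dots>, \<phi>\<^sub>n\<close>, whose last
  coefficient is \<open>coeff p n / \<kappa> n\<close>; the pairing with \<open>\<phi>b n\<close> reads it off.\<close>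

lemma pairing_with_phib:
  assumes "continuous_on (sphere 0 1) w" "biorthonormal w \<kappa> \<phi> \<phi>b" "degree p \<le> n"
  shows "pairing w p (\<phi>b n) = coeff p n / \<kappa> n"
proof -
  note bo = biorthonormalD[OF assms(2)]
  \<comment> \<open>Induction on a bound for the degree; \<open>m = 0\<close> stands for the zero polynomial.\<close>
  have "m \<le> Suc n \<Longrightarrow> \<forall>k\<ge>m. coeff p k = 0 \<Longrightarrow> pairing w p (\<phi>b n) = coeff p n / \<kappa> n" for m p
  proof (induction m arbitrary: p)
    case 0
    then have "p = 0" by (simp add: poly_eq_iff)
    then show ?case using pairing_smult_left[of w 0 0] by simp
  next
    case (Suc m)
    define c where "c = coeff p m / \<kappa> m"
    define q where "q = p - Polynomial.smult c (\<phi> m)"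
    have "coeff q k = 0" if "m \<le> k" for k
    proof (cases "k = m")
      case True
      then show ?thesis by (simp add: q_def c_def bo)
    next
      case False
      with that have "coeff (\<phi> m) k = 0" by (simp add: coeff_eq_0 bo)
      then show ?thesis using False that Suc.prems by (simp add: q_def)
    qed
    then have IH: "pairing w q (\<phi>b n) = coeff q n / \<kappa> n"
      using Suc by simp
    have "p = Polynomial.smult c (\<phi> m) + q" by (simp add: q_def)
    then have "pairing w p (\<phi>b n) = c * (if m = n then 1 else 0) + coeff q n / \<kappa> n"
      by (simp only: IH bo(6) pairing_add_left[OF assms(1)] pairing_smult_left)
    also have "\<dots> = coeff p n / \<kappa> n"
    proof (cases "m = n")
      case True
      then show ?thesis using \<open>\<And>k. m \<le> k \<Longrightarrow> coeff q k = 0\<close> by (simp add: c_def)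
    next
      case False
      with Suc.prems have "coeff (\<phi> m) n = 0" by (simp add: coeff_eq_0 bo)
      then show ?thesis using False by (simp add: q_def)
    qed
    finally show ?case .
  qed
  from this[of "Suc n" p] show ?thesis
    using assms(3) by (simp add: coeff_eq_0)
qed

lemma pairing_phi_with:
  assumes "continuous_on (sphere 0 1) w" "biorthonormal w \<kappa> \<phi> \<phi>b" "degree q \<le> n"
  shows "pairing w (\<phi> n) q = coeff q n / \<kappa> n"
  using pairing_with_phib[OF inverted_weight_continuous biorthonormal_swap, OF assms(1) assms(1,2,3)]
  by (simp add: pairing_swap assms(1))

section \<open>The Szego recurrences for the polynomials\<close>

text \<open>The leading coefficients and the constant terms of the two sides agree, so their difference
  is \<open>P = z Q\<close> with \<open>degree Q < n\<close>. Each of the three terms of \<open>P\<close> is orthogonal to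
  \<open>\<zeta>\<^sup>j\<close> for \<open>1 \<le> j \<le> n\<close>, hence \<open>Q\<close> is orthogonal to all polynomials of degree
  less than \<open>n\<close>, and the member of the second system of degree \<open>degree Q\<close> detects the leading
  coefficient of \<open>Q\<close>.\<close>

lemma szego_recurrence:
  assumes cont: "continuous_on (sphere 0 1) w" and bi: "biorthonormal w \<kappa> \<phi> \<phi>b"
  shows "Polynomial.smult (\<kappa> n) (\<phi> (Suc n)) =
    Polynomial.smult (\<kappa> (Suc n)) (pCons 0 (\<phi> n)) + Polynomial.smult (poly (\<phi> (Suc n)) 0) (reflect_poly (\<phi>b n))"
proof -
  note bo = biorthonormalD[OF bi]
  define c where "c = poly (\<phi> (Suc n)) 0"
  define P where "P = Polynomial.smult (\<kappa> n) (\<phi> (Suc n)) + Polynomial.smult (- \<kappa> (Suc n)) (pCons 0 (\<phi> n))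
     + Polynomial.smult (- c) (reflect_poly (\<phi>b n))"
  obtain a Q where PQ: "P = pCons a Q" by (cases P)
  have "coeff P 0 = 0"
    by (simp add: P_def c_def bo poly_0_coeff_0)
  then have a0: "a = 0" by (simp add: PQ)
  have "coeff Q k = 0" if "n \<le> k" for k
  proof -
    have "coeff P (Suc k) = 0"
      using that by (cases "k = n") (simp_all add: P_def coeff_reflect_poly bo coeff_eq_0)
    then show ?thesis by (simp add: PQ)
  qed
  have "Q = 0"
  proof (rule ccontr)
    assume "Q \<noteq> 0"
    define d where "d = degree Q"
    have "d < n"
      using \<open>Q \<noteq> 0\<close> \<open>\<And>k. n \<le> k \<Longrightarrow> coeff Q k = 0\<close>[of d] by (force simp: d_def)
    have "pairing w (reflect_poly (\<phi>b n)) (pCons 0 (\<phi>b d))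
        = pairing w (monom 1 (n - Suc d) * reflect_poly (\<phi>b d)) (\<phi>b n)"
      using \<open>d < n\<close> bo(1)[of d] bo(4,5)[of d]
      by (subst pairing_reflect_left) (auto simp: bo degree_pCons_eq_if reflect_poly_pCons')
    also have "\<dots> = 0"
    proof -
      have "degree (monom 1 (n - Suc d) * reflect_poly (\<phi>b d)) \<le> n - Suc d + d"
        by (rule order_trans[OF degree_mult_le] add_mono)+
           (use degree_reflect_poly_le[of "\<phi>b d"] in \<open>auto simp: degree_monom_eq bo\<close>)
      then have "degree (monom 1 (n - Suc d) * reflect_poly (\<phi>b d)) < n"
        using \<open>d < n\<close> by simp
      then show ?thesis
        by (simp add: pairing_with_phib[OF cont bi] coeff_eq_0)
    qed
    finally have star: "pairing w (reflect_poly (\<phi>b n)) (pCons 0 (\<phi>b d)) = 0" .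
    have "pairing w P (pCons 0 (\<phi>b d)) = 0"
      unfolding P_def pairing_add_left[OF cont] pairing_smult_left star pairing_pCons_pCons
      using \<open>d < n\<close> bo(6)[of n d]
      by (subst pairing_phi_with[OF cont bi])
         (auto simp: degree_pCons_eq_if bo coeff_eq_0)
    then have "pairing w Q (\<phi>b d) = 0"
      by (simp add: PQ a0 pairing_pCons_pCons)
    then have "coeff Q d = 0"
      by (simp add: pairing_with_phib[OF cont bi] d_def bo)
    with \<open>Q \<noteq> 0\<close> show False by (simp add: d_def)
  qed
  then have "P = 0" by (simp add: PQ a0)
  have "poly (Polynomial.smult (\<kappa> n) (\<phi> (Suc n))) x =
      poly (Polynomial.smult (\<kappa> (Suc n)) (pCons 0 (\<phi> n)) + Polynomial.smult c (reflect_poly (\<phi>b n))) x" for x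
    using arg_cong[OF \<open>P = 0\<close>, of "\<lambda>p. poly p x"] by (simp add: P_def diff_eq_eq)
  then show ?thesis
    unfolding c_def poly_eq_poly_eq_iff[symmetric] by (intro ext)
qed

text \<open>The recurrence of the second system, which is the first one for the inverted weight,
  evaluated at \<open>1/z\<close> and multiplied by \<open>z\<^sup>n\<^sup>+\<^sup>1\<close>; at the origin both sides are
  \<open>\<kappa>\<^sub>n \<kappa>\<^sub>n\<^sub>+\<^sub>1\<close>.\<close>

lemma szego_recurrence_star:
  assumes cont: "continuous_on (sphere 0 1) w" and bi: "biorthonormal w \<kappa> \<phi> \<phi>b"
  shows "\<kappa> n * phi_star \<phi>b (Suc n) z =
    \<kappa> (Suc n) * phi_star \<phi>b n z + poly (\<phi>b (Suc n)) 0 * z * poly (\<phi> n) z"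
proof (cases "z = 0")
  case True
  then show ?thesis by (simp add: phi_star_def biorthonormalD[OF bi])
next
  case False
  note bo = biorthonormalD[OF bi]
  have refl: "poly (reflect_poly (\<phi> n)) (1 / z) = poly (\<phi> n) z / z ^ n"
    using False by (simp add: poly_reflect_poly_nz bo field_simps)
  have "\<kappa> n * poly (\<phi>b (Suc n)) (1 / z) =
      \<kappa> (Suc n) * (poly (\<phi>b n) (1 / z) / z) + poly (\<phi>b (Suc n)) 0 * (poly (\<phi> n) z / z ^ n)"
    using arg_cong[OF szego_recurrence[OF inverted_weight_continuous[OF cont]
          biorthonormal_swap[OF cont bi], of n], of "\<lambda>p. poly p (1 / z)"] refl
    by simp
  then have "z ^ Suc n * (\<kappa> n * poly (\<phi>b (Suc n)) (1 / z)) = z ^ Suc n *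
      (\<kappa> (Suc n) * (poly (\<phi>b n) (1 / z) / z) + poly (\<phi>b (Suc n)) 0 * (poly (\<phi> n) z / z ^ n))"
    by simp
  also have "\<dots> = \<kappa> (Suc n) * (z ^ n * poly (\<phi>b n) (1 / z)) + poly (\<phi>b (Suc n)) 0 * z * poly (\<phi> n) z"
    using False by (simp add: field_simps)
  finally show ?thesis
    using False by (simp add: phi_star_def poly_reflect_poly_nz bo inverse_eq_divide mult_ac)
qed

section \<open>The Szego recurrences for the associated functions\<close>

definition kernel_transform :: "(complex \<Rightarrow> complex) \<Rightarrow> complex \<Rightarrow> complex" where
  "kernel_transform g z = circ_int (\<lambda>\<zeta>. (\<zeta> + z) / (\<zeta> - z) * g \<zeta>)"

lemma carath_scaled: "c * carath w z = kernel_transform (\<lambda>\<zeta>. w \<zeta> * c) z"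
  unfolding carath_def kernel_transform_def circ_int_cmult[symmetric] by (simp add: mult_ac)

text \<open>This form and the next absorb the special definition at \<open>n = 0\<close>, which differs from the
  general one only by the constant \<open>1 / \<kappa> 0\<close>.\<close>

lemma eps_eq_transform:
  assumes "biorthonormal w \<kappa> \<phi> \<phi>b"
  shows "eps w \<kappa> \<phi> n z =
    (if n = 0 then 1 / \<kappa> 0 else 0) + kernel_transform (\<lambda>\<zeta>. w \<zeta> * poly (\<phi> n) \<zeta>) z"
proof -
  have "poly (\<phi> 0) \<zeta> = \<kappa> 0" for \<zeta>
    using degree_eq_zeroE[of "\<phi> 0"] biorthonormalD(2,4)[OF assms, of 0] by force
  then show ?thesis
    by (cases "n = 0") (simp_all add: eps_def carath_scaled kernel_transform_def mult.assoc)
qed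

lemma eps_star_eq_transform:
  assumes "biorthonormal w \<kappa> \<phi> \<phi>b"
  shows "eps_star w \<kappa> \<phi>b n z =
    (if n = 0 then 1 / \<kappa> 0 else 0) - z ^ n * kernel_transform (\<lambda>\<zeta>. w \<zeta> * poly (\<phi>b n) (1 / \<zeta>)) z"
proof -
  have "poly (\<phi>b 0) \<zeta> = \<kappa> 0" for \<zeta>
    using degree_eq_zeroE[of "\<phi>b 0"] biorthonormalD(3,5)[OF assms, of 0] by force
  then show ?thesis
    by (cases "n = 0") (simp_all add: eps_star_def carath_scaled kernel_transform_def mult.assoc)
qed

lemma kernel_continuous:
  fixes g :: "complex \<Rightarrow> complex"
  assumes "continuous_on (sphere 0 1) g" "norm z \<noteq> 1"
  shows "continuous_on (sphere 0 1) (\<lambda>\<zeta>. (\<zeta> + z) / (\<zeta> - z) * g \<zeta>)"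
  by (intro continuous_intros assms(1)) (use assms(2) in auto)

text \<open>The kernel changes sign when both arguments are inverted.\<close>

lemma kernel_transform_inversion:
  assumes cont: "continuous_on (sphere 0 1) g" and z: "z \<noteq> 0" "norm z \<noteq> 1"
  shows "kernel_transform (\<lambda>\<zeta>. g (1 / \<zeta>)) (1 / z) = - kernel_transform g z"
proof -
  have "kernel_transform (\<lambda>\<zeta>. g (1 / \<zeta>)) (1 / z)
      = circ_int (\<lambda>\<zeta>. - 1 * ((1 / \<zeta> + z) / (1 / \<zeta> - z) * g (1 / \<zeta>)))"
    unfolding kernel_transform_def
  proof (rule circ_int_cong)
    fix \<zeta> :: complex assume "norm \<zeta> = 1"
    with z have "\<zeta> \<noteq> 0" "\<zeta> * z \<noteq> 1"
      by (auto dest: arg_cong[of _ _ norm] simp: norm_mult)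
    then have "(\<zeta> + 1 / z) / (\<zeta> - 1 / z) = - ((1 / \<zeta> + z) / (1 / \<zeta> - z))"
      using z by (simp add: divide_simps) (simp add: algebra_simps)
    then show "(\<zeta> + 1 / z) / (\<zeta> - 1 / z) * g (1 / \<zeta>)
        = - 1 * ((1 / \<zeta> + z) / (1 / \<zeta> - z) * g (1 / \<zeta>))"
      by simp
  qed
  also have "\<dots> = - kernel_transform g z"
    unfolding circ_int_cmult kernel_transform_def
    using circ_int_inversion[OF kernel_continuous[OF cont z(2)]] by simp
  finally show ?thesis .
qed

lemma eps_star_inversion:
  assumes cont: "continuous_on (sphere 0 1) w" and bi: "biorthonormal w \<kappa> \<phi> \<phi>b"
    and z: "z \<noteq> 0" "norm z \<noteq> 1"
  shows "eps_star w \<kappa> \<phi>b n z = z ^ n * eps (\<lambda>\<zeta>. w (1 / \<zeta>)) \<kappa> \<phi>b n (1 / z)"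
proof -
  have "continuous_on (sphere 0 1) (\<lambda>\<zeta>. w \<zeta> * poly (\<phi>b n) (1 / \<zeta>))"
    by (intro continuous_intros cont) auto
  from kernel_transform_inversion[OF this z] show ?thesis
    by (simp add: eps_star_eq_transform[OF bi] algebra_simps
        eps_eq_transform[OF biorthonormal_swap[OF cont bi]])
qed

lemma eps_inversion:
  assumes cont: "continuous_on (sphere 0 1) w" and bi: "biorthonormal w \<kappa> \<phi> \<phi>b"
    and z: "z \<noteq> 0" "norm z \<noteq> 1"
  shows "eps w \<kappa> \<phi> n z = z ^ n * eps_star (\<lambda>\<zeta>. w (1 / \<zeta>)) \<kappa> \<phi> n (1 / z)"
  using eps_star_inversion[OF inverted_weight_continuous[OF cont] biorthonormal_swap[OF cont bi],
      of "1 / z" n] z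
  by (simp add: norm_divide power_divide)

text \<open>Let \<open>c = \<phi>\<^sub>n\<^sub>+\<^sub>1(0)\<close>. The claim concerns the kernel transform of
    \<open>\<kappa>\<^sub>n \<phi>\<^sub>n\<^sub>+\<^sub>1(\<zeta>) - \<kappa>\<^sub>n\<^sub>+\<^sub>1 z \<phi>\<^sub>n(\<zeta>) - c z\<^sup>n \<phi>b\<^sub>n(1/\<zeta>)\<close>.
  By the polynomial recurrence this equals
    \<open>\<kappa>\<^sub>n\<^sub>+\<^sub>1 (\<zeta> - z) \<phi>\<^sub>n(\<zeta>) + c (\<zeta>\<^sup>n - z\<^sup>n) \<phi>b\<^sub>n(1/\<zeta>)\<close>,
  which has the factor \<open>\<zeta> - z\<close>. After cancellation the two terms contribute
  \<open>- c/\<kappa>\<^sub>n\<close> and \<open>c/\<kappa>\<^sub>n\<close> if \<open>n > 0\<close>; for \<open>n = 0\<close> the sum is not zero but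
  \<open>(\<kappa>\<^sub>1 z - c)/\<kappa>\<^sub>0\<close>, and this is made up for by the constants \<open>1/\<kappa>\<^sub>0\<close> in
  the definition of \<open>\<epsilon>\<^sub>0\<close> and \<open>\<epsilon>\<^sub>0\<^sup>*\<close>.\<close>

lemma eps_recurrence:
  assumes cont: "continuous_on (sphere 0 1) w" and bi: "biorthonormal w \<kappa> \<phi> \<phi>b"
    and z: "norm z \<noteq> 1"
  shows "\<kappa> n * eps w \<kappa> \<phi> (Suc n) z =
    \<kappa> (Suc n) * z * eps w \<kappa> \<phi> n z - poly (\<phi> (Suc n)) 0 * eps_star w \<kappa> \<phi>b n z"
proof -
  note bo = biorthonormalD[OF bi]
  define c where "c = poly (\<phi> (Suc n)) 0"
  \<comment> \<open>\<open>S\<close> is the quotient of \<open>\<zeta>\<^sup>n - z\<^sup>n\<close> by \<open>\<zeta> - z\<close>, and \<open>R\<close> its product with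
    the numerator of the kernel, monic of degree \<open>n\<close> unless \<open>n = 0\<close>, where both vanish.\<close>
  define S where "S = (\<Sum>i<n. monom (z ^ (n - Suc i)) i)"
  define R where "R = [:z, 1:] * S"
  have coeff_S: "coeff S k = (if k < n then z ^ (n - Suc k) else 0)" for k
    by (simp add: S_def coeff_sum sum.delta')
  have coeff_R: "coeff R k = z * coeff S k + (case k of 0 \<Rightarrow> 0 | Suc j \<Rightarrow> coeff S j)" for k
    by (simp add: R_def coeff_pCons split: nat.split)
  have degR: "degree R \<le> n"
    by (rule degree_le) (auto simp: coeff_R coeff_S split: nat.split)
  have Rn: "coeff R n = (if n = 0 then 0 else 1)"
    by (auto simp: coeff_R coeff_S split: nat.split)
  have polyR: "poly R \<zeta> = (\<zeta> + z) * poly S \<zeta>" for \<zeta>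
    by (simp add: R_def algebra_simps)
  have szego: "\<kappa> n * poly (\<phi> (Suc n)) \<zeta> =
      \<kappa> (Suc n) * \<zeta> * poly (\<phi> n) \<zeta> + c * poly (reflect_poly (\<phi>b n)) \<zeta>" for \<zeta>
    using arg_cong[OF szego_recurrence[OF cont bi, of n], of "\<lambda>p. poly p \<zeta>"]
    by (simp add: c_def)
  have K: "(\<zeta> + z) / (\<zeta> - z) * (w \<zeta> * (\<kappa> n * poly (\<phi> (Suc n)) \<zeta> - \<kappa> (Suc n) * z * poly (\<phi> n) \<zeta>
        - c * z ^ n * poly (\<phi>b n) (1 / \<zeta>)))
      = w \<zeta> * poly (Polynomial.smult (\<kappa> (Suc n)) ([:z, 1:] * \<phi> n)) \<zeta> * poly 1 (1 / \<zeta>)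
        + w \<zeta> * poly (Polynomial.smult c R) \<zeta> * poly (\<phi>b n) (1 / \<zeta>)"
    if "norm \<zeta> = 1" for \<zeta>
  proof -
    have nz: "\<zeta> \<noteq> 0" "\<zeta> - z \<noteq> 0" using that z by auto
    have pow: "\<zeta> ^ n - z ^ n = (\<zeta> - z) * poly S \<zeta>"
      unfolding power_diff_sumr2 by (simp add: S_def poly_sum poly_monom)
    have "\<kappa> n * poly (\<phi> (Suc n)) \<zeta> - \<kappa> (Suc n) * z * poly (\<phi> n) \<zeta>
        - c * z ^ n * poly (\<phi>b n) (1 / \<zeta>)
      = (\<zeta> - z) * (\<kappa> (Suc n) * poly (\<phi> n) \<zeta>) + c * (\<zeta> ^ n - z ^ n) * poly (\<phi>b n) (1 / \<zeta>)"
      using nz unfolding szego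
      by (simp add: poly_reflect_poly_nz bo inverse_eq_divide) (simp add: algebra_simps)
    also have "\<dots>
      = (\<zeta> - z) * (\<kappa> (Suc n) * poly (\<phi> n) \<zeta> + c * poly S \<zeta> * poly (\<phi>b n) (1 / \<zeta>))"
      unfolding pow by (simp add: algebra_simps)
    finally have fin: "\<kappa> n * poly (\<phi> (Suc n)) \<zeta> - \<kappa> (Suc n) * z * poly (\<phi> n) \<zeta>
        - c * z ^ n * poly (\<phi>b n) (1 / \<zeta>)
      = (\<zeta> - z) * (\<kappa> (Suc n) * poly (\<phi> n) \<zeta> + c * poly S \<zeta> * poly (\<phi>b n) (1 / \<zeta>))" .
    have can: "(\<zeta> + z) / (\<zeta> - z) * (w \<zeta> * ((\<zeta> - z) * x)) = (\<zeta> + z) * w \<zeta> * x" for x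
      using nz by simp
    show ?thesis
      unfolding fin can polyR poly_smult by (simp add: distrib_left distrib_right mult_ac)
  qed
  define G where "G p = kernel_transform (\<lambda>\<zeta>. w \<zeta> * p \<zeta>) z" for p
  have contG: "continuous_on (sphere 0 1) (\<lambda>\<zeta>. (\<zeta> + z) / (\<zeta> - z) * (w \<zeta> * p \<zeta>))"
    if "continuous_on (sphere 0 1) p" for p
    by (intro kernel_continuous z continuous_intros cont that)
  have G_add: "G (\<lambda>\<zeta>. p \<zeta> + q \<zeta>) = G p + G q"
    if "continuous_on (sphere 0 1) p" "continuous_on (sphere 0 1) q" for p q
    unfolding G_def kernel_transform_def circ_int_add[OF contG[OF that(1)] contG[OF that(2)], symmetric]
    by (simp only: distrib_left)
  have G_cmult: "G (\<lambda>\<zeta>. x * p \<zeta>) = x * G p" for x p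
    unfolding G_def kernel_transform_def circ_int_cmult[symmetric] by (simp only: mult_ac)
  have cont_poly: "continuous_on (sphere 0 1) (poly p)"
    "continuous_on (sphere 0 1) (\<lambda>\<zeta>. poly p (1 / \<zeta>))" for p :: "complex poly"
    by (intro continuous_intros; auto)+
  have "\<kappa> n * G (poly (\<phi> (Suc n))) + (- (\<kappa> (Suc n) * z) * G (poly (\<phi> n))
       + - (c * z ^ n) * G (\<lambda>\<zeta>. poly (\<phi>b n) (1 / \<zeta>)))
    = G (\<lambda>\<zeta>. \<kappa> n * poly (\<phi> (Suc n)) \<zeta> + (- (\<kappa> (Suc n) * z) * poly (\<phi> n) \<zeta>
        + - (c * z ^ n) * poly (\<phi>b n) (1 / \<zeta>)))"
    by (simp only: G_add G_cmult cont_poly continuous_on_add continuous_on_mult continuous_on_const)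
  also have "\<dots> = circ_int (\<lambda>\<zeta>. (\<zeta> + z) / (\<zeta> - z) * (w \<zeta> * (\<kappa> n * poly (\<phi> (Suc n)) \<zeta> - \<kappa> (Suc n) * z * poly (\<phi> n) \<zeta>
        - c * z ^ n * poly (\<phi>b n) (1 / \<zeta>))))"
    unfolding G_def kernel_transform_def by (intro circ_int_cong) simp
  also have "\<dots> = pairing w (Polynomial.smult (\<kappa> (Suc n)) ([:z, 1:] * \<phi> n)) 1
      + pairing w (Polynomial.smult c R) (\<phi>b n)"
    unfolding pairing_def
    by (subst circ_int_add[symmetric])
       (intro continuous_intros cont circ_int_cong K; force)+
  also have "[:z, 1:] * \<phi> n = Polynomial.smult z (\<phi> n) + pCons 0 (\<phi> n)"
    by simp
  finally have main: "\<kappa> n * G (poly (\<phi> (Suc n))) - \<kappa> (Suc n) * z * G (poly (\<phi> n))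
       - c * z ^ n * G (\<lambda>\<zeta>. poly (\<phi>b n) (1 / \<zeta>))
    = \<kappa> (Suc n) * (z * pairing w (\<phi> n) 1 + pairing w (pCons 0 (\<phi> n)) 1)
      + c * pairing w R (\<phi>b n)"
    unfolding pairing_smult_left pairing_add_left[OF cont]
    by (simp only: mult_minus_left add.assoc diff_conv_add_uminus)
  have p1: "pairing w (\<phi> n) 1 = (if n = 0 then 1 / \<kappa> 0 else 0)"
    by (simp add: pairing_phi_with[OF cont bi])
  \<comment> \<open>Bi-orthogonality does not reach the pairing of \<open>z \<phi>\<^sub>n\<close> with \<open>1\<close> directly, but the
    polynomial recurrence expresses \<open>z \<phi>\<^sub>n\<close> by terms whose pairing with \<open>1\<close> is known.\<close>
  have "\<kappa> n * pairing w (\<phi> (Suc n)) 1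
      = \<kappa> (Suc n) * pairing w (pCons 0 (\<phi> n)) 1 + c * pairing w (reflect_poly (\<phi>b n)) 1"
    using arg_cong[OF szego_recurrence[OF cont bi, of n], of "\<lambda>p. pairing w p 1"]
    by (simp only: pairing_smult_left pairing_add_left[OF cont] c_def)
  moreover have "pairing w (\<phi> (Suc n)) 1 = 0"
    by (simp add: pairing_phi_with[OF cont bi])
  moreover have "pairing w (reflect_poly (\<phi>b n)) 1 = 1 / \<kappa> n"
    by (simp add: pairing_reflect_left pairing_with_phib[OF cont bi] bo degree_monom_eq)
  ultimately have p2: "\<kappa> (Suc n) * pairing w (pCons 0 (\<phi> n)) 1 = - c / \<kappa> n"
    by (simp add: eq_neg_iff_add_eq_0)
  have p3: "pairing w R (\<phi>b n) = (if n = 0 then 0 else 1 / \<kappa> n)"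
    by (simp add: pairing_with_phib[OF cont bi degR] Rn)
  have defect: "\<kappa> (Suc n) * (z * pairing w (\<phi> n) 1 + pairing w (pCons 0 (\<phi> n)) 1)
      + c * pairing w R (\<phi>b n) = (if n = 0 then \<kappa> 1 * z / \<kappa> 0 - c / \<kappa> 0 else 0)"
    unfolding distrib_left p1 p2 p3 by simp
  have "\<kappa> n * eps w \<kappa> \<phi> (Suc n) z = \<kappa> n * G (poly (\<phi> (Suc n)))"
    by (simp add: eps_eq_transform[OF bi] G_def)
  also have "\<dots> = \<kappa> (Suc n) * z * G (poly (\<phi> n)) + c * z ^ n * G (\<lambda>\<zeta>. poly (\<phi>b n) (1 / \<zeta>))
       + (if n = 0 then \<kappa> 1 * z / \<kappa> 0 - c / \<kappa> 0 else 0)"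
    using main[unfolded defect] by (simp only: diff_eq_eq add_ac)
  also have "\<dots> = \<kappa> (Suc n) * z * eps w \<kappa> \<phi> n z - c * eps_star w \<kappa> \<phi>b n z"
    unfolding eps_eq_transform[OF bi] eps_star_eq_transform[OF bi] G_def
    by (cases "n = 0") (simp_all add: algebra_simps)
  finally show ?thesis unfolding c_def .
qed

text \<open>Inversion says nothing at the origin, where the starred recurrence holds because its three
  terms vanish. For \<open>n = 0\<close> this is the normalization \<open>\<kappa>\<^sub>0\<^sup>2 w\<^sub>0 = 1\<close>.\<close>

lemma eps_star_at_0:
  assumes cont: "continuous_on (sphere 0 1) w" and bi: "biorthonormal w \<kappa> \<phi> \<phi>b"
  shows "eps_star w \<kappa> \<phi>b n 0 = 0"
proof (cases "n = 0")
  case True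
  have "kernel_transform (\<lambda>\<zeta>. w \<zeta> * poly (\<phi>b 0) (1 / \<zeta>)) 0 = pairing w 1 (\<phi>b 0)"
    unfolding kernel_transform_def pairing_def by (rule circ_int_cong) auto
  also have "\<dots> = 1 / \<kappa> 0"
    by (simp add: pairing_with_phib[OF cont bi])
  finally show ?thesis using True by (simp add: eps_star_eq_transform[OF bi])
qed (simp add: eps_star_def)

lemma eps_star_recurrence:
  assumes cont: "continuous_on (sphere 0 1) w" and bi: "biorthonormal w \<kappa> \<phi> \<phi>b"
    and z: "norm z \<noteq> 1"
  shows "\<kappa> n * eps_star w \<kappa> \<phi>b (Suc n) z =
    \<kappa> (Suc n) * eps_star w \<kappa> \<phi>b n z - poly (\<phi>b (Suc n)) 0 * z * eps w \<kappa> \<phi> n z"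
proof (cases "z = 0")
  case True
  then show ?thesis by (simp add: eps_star_at_0[OF cont bi])
next
  case False
  have "norm (1 / z) \<noteq> 1" using z by (simp add: norm_divide)
  from eps_recurrence[OF inverted_weight_continuous[OF cont] biorthonormal_swap[OF cont bi] this, of n]
  have "z ^ Suc n * (\<kappa> n * eps (\<lambda>\<zeta>. w (1 / \<zeta>)) \<kappa> \<phi>b (Suc n) (1 / z)) = z ^ Suc n *
    (\<kappa> (Suc n) * (1 / z) * eps (\<lambda>\<zeta>. w (1 / \<zeta>)) \<kappa> \<phi>b n (1 / z)
      - poly (\<phi>b (Suc n)) 0 * eps_star (\<lambda>\<zeta>. w (1 / \<zeta>)) \<kappa> \<phi> n (1 / z))"
    by simp
  then show ?thesis
    unfolding eps_star_inversion[OF cont bi False z] eps_inversion[OF cont bi False z]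
    using False by (simp add: algebra_simps)
qed

section \<open>Differentiability off the circle\<close>

lemma cauchy_transform_differentiable:
  assumes cont: "continuous_on (sphere 0 1) f" and z: "norm z \<noteq> 1"
  shows "(\<lambda>u. contour_integral (circlepath 0 1) (\<lambda>\<zeta>. f \<zeta> / (\<zeta> - u))) field_differentiable (at z)"
proof -
  have "((\<lambda>u. contour_integral (circlepath 0 1) (\<lambda>\<zeta>. f \<zeta> / (\<zeta> - u))) has_field_derivative
      of_nat 1 * contour_integral (circlepath 0 1) (\<lambda>\<zeta>. f \<zeta> / (\<zeta> - z) ^ Suc 1)) (at z)"
  proof (rule Cauchy_next_derivative(2)[where S = UNIV and B = "2 * pi"])
    fix u assume u: "u \<in> UNIV - path_image (circlepath (0::complex) 1)"
    have "continuous_on (path_image (circlepath 0 1)) (\<lambda>\<zeta>. f \<zeta> / (\<zeta> - u) ^ 1)"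
      using u by (auto intro!: continuous_intros cont)
    from has_contour_integral_integral[OF contour_integrable_continuous_circlepath[OF this]]
    show "((\<lambda>\<zeta>. f \<zeta> / (\<zeta> - u) ^ 1) has_contour_integral
        contour_integral (circlepath 0 1) (\<lambda>\<zeta>. f \<zeta> / (\<zeta> - u))) (circlepath 0 1)"
      by simp
  qed (use assms in \<open>auto simp: vector_derivative_circlepath norm_mult\<close>)
  then show ?thesis by (auto simp: field_differentiable_def)
qed

text \<open>Since \<open>(\<zeta> + z)/(\<zeta> - z) = 2 \<zeta>/(\<zeta> - z) - 1\<close>, the kernel transform is a Cauchy
  transform up to a constant.\<close>

lemma kernel_transform_differentiable:
  assumes cont: "continuous_on (sphere 0 1) g" and z: "norm z \<noteq> 1"
  shows "kernel_transform g field_differentiable (at z)"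
proof -
  let ?C = "\<lambda>u. contour_integral (circlepath 0 1) (\<lambda>\<zeta>. g \<zeta> / (of_real pi * \<i>) / (\<zeta> - u))"
  have eq: "?C u - circ_int g = kernel_transform g u" if "u \<in> - sphere 0 1" for u
  proof -
    have ne: "\<zeta> \<noteq> u" if "norm \<zeta> = 1" for \<zeta> using that \<open>u \<in> - sphere 0 1\<close> by auto
    have "?C u = circ_int (\<lambda>\<zeta>. 2 * \<zeta> / (\<zeta> - u) * g \<zeta>)"
      unfolding circ_int_def by (rule contour_integral_cong) (auto simp: divide_simps)
    also have "\<dots> = circ_int (\<lambda>\<zeta>. (\<zeta> + u) / (\<zeta> - u) * g \<zeta> + g \<zeta>)"
      by (rule circ_int_cong) (use ne in \<open>auto simp: divide_simps, simp add: algebra_simps\<close>)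
    also have "\<dots> = kernel_transform g u + circ_int g"
      unfolding kernel_transform_def
      by (intro circ_int_add cont kernel_continuous) (use that in auto)
    finally show ?thesis by simp
  qed
  have "(\<lambda>u. ?C u - circ_int g) field_differentiable (at z)"
    by (intro field_differentiable_diff cauchy_transform_differentiable z continuous_intros cont) auto
  moreover have "\<forall>\<^sub>F u in nhds z. ?C u - circ_int g = kernel_transform g u"
  proof (rule eventually_mono[OF eventually_nhds_in_open])
    show "open (- sphere 0 1 :: complex set)" by (simp add: open_Compl)
    show "z \<in> - sphere 0 1" using z by simp
  qed (rule eq)
  ultimately show ?thesis
    unfolding field_differentiable_def using DERIV_cong_ev[OF refl _ refl] by fast
qed

lemma eps_differentiable:
  assumes "continuous_on (sphere 0 1) w" "biorthonormal w \<kappa> \<phi> \<phi>b" "norm z \<noteq> 1"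
  shows "eps w \<kappa> \<phi> n field_differentiable (at z)"
  unfolding eps_eq_transform[OF assms(2), abs_def]
  by (intro field_differentiable_add field_differentiable_const kernel_transform_differentiable
      continuous_intros assms)

lemma eps_star_differentiable:
  assumes "continuous_on (sphere 0 1) w" "biorthonormal w \<kappa> \<phi> \<phi>b" "norm z \<noteq> 1"
  shows "eps_star w \<kappa> \<phi>b n field_differentiable (at z)"
  unfolding eps_star_eq_transform[OF assms(2), abs_def]
proof (rule field_differentiable_diff[OF field_differentiable_const field_differentiable_mult])
  show "(\<lambda>u. u ^ n) field_differentiable (at z)"
    by (intro field_differentiable_power field_differentiable_ident)
  show "kernel_transform (\<lambda>\<zeta>. w \<zeta> * poly (\<phi>b n) (1 / \<zeta>)) field_differentiable (at z)"
    by (intro kernel_transform_differentiable continuous_intros assms) auto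
qed

section \<open>The matrix equation\<close>

lemma has_mat_derivative_2x2:
  "has_mat_derivative (\<lambda>u. mat_of_rows_list 2 [[a u, b u], [c u, d u]])
     (mat_of_rows_list 2 [[a', b'], [c', d']]) z \<longleftrightarrow>
   (a has_field_derivative a') (at z) \<and> (b has_field_derivative b') (at z) \<and>
   (c has_field_derivative c') (at z) \<and> (d has_field_derivative d') (at z)"
  by (auto simp: has_mat_derivative_def mat_of_rows_list_def less_Suc_eq numeral_2_eq_2)

lemma scaled_mult_2x2:
  "(k \<cdot>\<^sub>m mat_of_rows_list 2 [[a, b], [c, d]]) * mat_of_rows_list 2 [[p, q], [r, s]] =
   mat_of_rows_list 2 [[k * (a * p + b * r), k * (a * q + b * s)],
                       [k * (c * p + d * r), k * (c * q + d * s)]]"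
  for k :: complex
  by (rule eq_matI)
     (auto simp: mat_of_rows_list_def scalar_prod_def less_Suc_eq numeral_2_eq_2 algebra_simps)

lemma has_field_derivative_iff_scaled_deriv:
  assumes "f field_differentiable (at z)" "c \<noteq> 0"
  shows "(f has_field_derivative D) (at z) \<longleftrightarrow> c * deriv f z = c * D"
proof -
  have "(f has_field_derivative D) (at z) \<longleftrightarrow> deriv f z = D"
    using field_differentiable_derivI[OF assms(1)] DERIV_imp_deriv by metis
  then show ?thesis using assms(2) by simp
qed

text \<open>Here the semiclassical relation between \<open>w\<close>, \<open>V\<close> and \<open>W\<close> acts: the derivative
  of \<open>1/w\<close> appears as the term \<open>2 * V * f z\<close>, the shift by which the relations for the
  second column differ from those for the first.\<close>

lemma has_field_derivative_quotient_iff: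
  assumes f: "f field_differentiable (at z)" and w: "w field_differentiable (at z)"
    and nz: "W \<noteq> 0" "w z \<noteq> 0" and sc: "W * deriv w z = 2 * V * w z"
  shows "((\<lambda>u. f u / w u) has_field_derivative D) (at z) \<longleftrightarrow>
    W * deriv f z = 2 * V * f z + W * w z * D"
proof -
  have "(\<lambda>u. f u / w u) field_differentiable (at z)"
    using f w nz by (intro field_differentiable_divide) auto
  moreover have "deriv (\<lambda>u. f u / w u) z = (deriv f z * w z - f z * deriv w z) / (w z)\<^sup>2"
    using f w nz by (intro deriv_divide) auto
  ultimately have "((\<lambda>u. f u / w u) has_field_derivative D) (at z) \<longleftrightarrow>
     (W * w z) * ((deriv f z * w z - f z * deriv w z) / (w z)\<^sup>2) = (W * w z) * D"
    using nz by (subst has_field_derivative_iff_scaled_deriv[where c = "W * w z"]) auto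
  also have "(W * w z) * ((deriv f z * w z - f z * deriv w z) / (w z)\<^sup>2)
      = W * deriv f z - f z * (W * deriv w z) / w z"
    using nz by (simp add: field_simps power2_eq_square)
  also have "\<dots> = W * deriv f z - 2 * V * f z"
    using nz by (simp add: sc)
  finally show ?thesis by (simp only: diff_eq_eq add.commute)
qed

theorem corollary2p4:
  fixes cuts :: "complex set"
    and w W V :: "complex \<Rightarrow> complex"
    and \<kappa> :: "nat \<Rightarrow> complex"
    and \<phi> \<phi>b :: "nat \<Rightarrow> complex poly"
    and \<Theta> \<Omega> \<Theta>s \<Omega>s :: "nat \<Rightarrow> complex \<Rightarrow> complex"
  assumes weight: "admissible_weight cuts w"
    and biorth: "biorthonormal w \<kappa> \<phi> \<phi>b"
    and W_nonzero: "\<exists>z\<in>- cuts. W z \<noteq> 0"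
    and semiclassical: "\<forall>z\<in>- cuts. W z * deriv w z = 2 * V z * w z"
  shows "\<forall>n. \<forall>z\<in>- cuts. norm z \<noteq> 1 \<and> W z \<noteq> 0 \<and> w z \<noteq> 0 \<longrightarrow>
    ((W z * deriv (poly (\<phi> n)) z
        = \<Theta> n z * poly (\<phi> (n + 1)) z - (\<Omega> n z + V z) * poly (\<phi> n) z \<and>
      W z * deriv (phi_star \<phi>b n) z
        = - \<Theta>s n z * phi_star \<phi>b (n + 1) z + (\<Omega>s n z - V z) * phi_star \<phi>b n z \<and>
      W z * deriv (eps w \<kappa> \<phi> n) z
        = \<Theta> n z * eps w \<kappa> \<phi> (n + 1) z - (\<Omega> n z - V z) * eps w \<kappa> \<phi> n z \<and>
      W z * deriv (eps_star w \<kappa> \<phi>b n) z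
        = - \<Theta>s n z * eps_star w \<kappa> \<phi>b (n + 1) z + (\<Omega>s n z + V z) * eps_star w \<kappa> \<phi>b n z)
     \<longleftrightarrow>
     has_mat_derivative (Ymat w \<kappa> \<phi> \<phi>b n)
       (Amat \<kappa> \<phi> \<phi>b W V \<Theta> \<Omega> \<Theta>s \<Omega>s n z * Ymat w \<kappa> \<phi> \<phi>b n z) z)"
proof (intro allI ballI impI)
  fix n z
  assume "z \<in> - cuts" and "norm z \<noteq> 1 \<and> W z \<noteq> 0 \<and> w z \<noteq> 0"
  then have z: "norm z \<noteq> 1" and nz: "W z \<noteq> 0" "w z \<noteq> 0" by auto
  note bo = biorthonormalD[OF biorth]
  have \<kappa>: "\<kappa> n \<noteq> 0" by (rule bo)
  obtain r R where "r < 1" "1 < R" "\<And>z. r < norm z \<Longrightarrow> norm z < R \<Longrightarrow>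
      ((\<lambda>k::int. fourier_coeff w k * z powi k) has_sum w z) UNIV"
    using weight unfolding admissible_weight_def by blast
  then have cont: "continuous_on (sphere 0 1) w"
    by (rule laurent_weight_continuous_on_circle)
  have w: "w field_differentiable (at z)"
    using weight \<open>z \<in> - cuts\<close> unfolding admissible_weight_def
    by (meson holomorphic_on_imp_differentiable_at open_Compl)
  have sc: "W z * deriv w z = 2 * V z * w z"
    using semiclassical \<open>z \<in> - cuts\<close> by blast
  have p: "poly q field_differentiable (at z)" for q :: "complex poly"
    using poly_DERIV field_differentiable_def by blast
  have ps: "phi_star \<phi>b n field_differentiable (at z)"
    unfolding phi_star_def[abs_def] by (rule p)
  note e = eps_differentiable[OF cont biorth z, of n]
  note es = eps_star_differentiable[OF cont biorth z, of n]
  define a b c where "a = \<kappa> (n + 1) / \<kappa> n" and "b = poly (\<phi> (n + 1)) 0 / \<kappa> n"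
    and "c = poly (\<phi>b (n + 1)) 0 / \<kappa> n"
  have solve: "x = y / \<kappa> n" if "\<kappa> n * x = y" for x y
    using that \<kappa> by (simp add: field_simps)
  have rec: "poly (\<phi> (n + 1)) z = a * z * poly (\<phi> n) z + b * phi_star \<phi>b n z"
    "phi_star \<phi>b (n + 1) z = a * phi_star \<phi>b n z + c * z * poly (\<phi> n) z"
    "eps w \<kappa> \<phi> (n + 1) z = a * z * eps w \<kappa> \<phi> n z - b * eps_star w \<kappa> \<phi>b n z"
    "eps_star w \<kappa> \<phi>b (n + 1) z = a * eps_star w \<kappa> \<phi>b n z - c * z * eps w \<kappa> \<phi> n z"
    using arg_cong[OF szego_recurrence[OF cont biorth, of n], of "\<lambda>p. poly p z", simplified, THEN solve]
      solve[OF szego_recurrence_star[OF cont biorth, of n z]]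
      solve[OF eps_recurrence[OF cont biorth z, of n]]
      solve[OF eps_star_recurrence[OF cont biorth z, of n]]
    by (simp_all add: a_def b_def c_def phi_star_def add_divide_distrib diff_divide_distrib mult_ac)
  have neg: "((\<lambda>u. - (eps_star w \<kappa> \<phi>b n u / w u)) has_field_derivative D) (at z) \<longleftrightarrow>
     ((\<lambda>u. eps_star w \<kappa> \<phi>b n u / w u) has_field_derivative - D) (at z)" for D
    using DERIV_minus[of "\<lambda>u. eps_star w \<kappa> \<phi>b n u / w u" "- D"]
      DERIV_minus[of "\<lambda>u. - (eps_star w \<kappa> \<phi>b n u / w u)" D] by auto
  show "(W z * deriv (poly (\<phi> n)) z
        = \<Theta> n z * poly (\<phi> (n + 1)) z - (\<Omega> n z + V z) * poly (\<phi> n) z \<and>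
      W z * deriv (phi_star \<phi>b n) z
        = - \<Theta>s n z * phi_star \<phi>b (n + 1) z + (\<Omega>s n z - V z) * phi_star \<phi>b n z \<and>
      W z * deriv (eps w \<kappa> \<phi> n) z
        = \<Theta> n z * eps w \<kappa> \<phi> (n + 1) z - (\<Omega> n z - V z) * eps w \<kappa> \<phi> n z \<and>
      W z * deriv (eps_star w \<kappa> \<phi>b n) z
        = - \<Theta>s n z * eps_star w \<kappa> \<phi>b (n + 1) z + (\<Omega>s n z + V z) * eps_star w \<kappa> \<phi>b n z)
     \<longleftrightarrow>
     has_mat_derivative (Ymat w \<kappa> \<phi> \<phi>b n)
       (Amat \<kappa> \<phi> \<phi>b W V \<Theta> \<Omega> \<Theta>s \<Omega>s n z * Ymat w \<kappa> \<phi> \<phi>b n z) z"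
    (is "?D1 \<and> ?D2 \<and> ?D3 \<and> ?D4 \<longleftrightarrow> _")
  proof -
    note iff = has_field_derivative_iff_scaled_deriv[OF _ nz(1)]
      has_field_derivative_quotient_iff[OF _ w nz sc]
    have cancel: "W z * w z * (1 / W z * (A * (x / w z) + B * - (y / w z))) = A * x - B * y" for A B x y
    proof -
      have "W z * w z * (1 / W z * (A * (x / w z) + B * - (y / w z)))
          = (W z * (1 / W z)) * (A * (w z * (x / w z)) - B * (w z * (y / w z)))"
        by (simp add: field_simps)
      then show ?thesis using nz by simp
    qed
    have 1: "(poly (\<phi> n) has_field_derivative
        1 / W z * (- (\<Omega> n z + V z - a * z * \<Theta> n z) * poly (\<phi> n) z + b * \<Theta> n z * phi_star \<phi>b n z)) (at z)
      \<longleftrightarrow> ?D1"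
      using nz unfolding iff(1)[OF p] rec by (simp add: algebra_simps)
    have 2: "(phi_star \<phi>b n has_field_derivative
        1 / W z * (- (c * z * \<Theta>s n z) * poly (\<phi> n) z + (\<Omega>s n z - V z - a * \<Theta>s n z) * phi_star \<phi>b n z)) (at z)
      \<longleftrightarrow> ?D2"
      using nz unfolding iff(1)[OF ps] rec by (simp add: algebra_simps)
    have 3: "((\<lambda>u. eps w \<kappa> \<phi> n u / w u) has_field_derivative
        1 / W z * (- (\<Omega> n z + V z - a * z * \<Theta> n z) * (eps w \<kappa> \<phi> n z / w z)
          + b * \<Theta> n z * - (eps_star w \<kappa> \<phi>b n z / w z))) (at z)
      \<longleftrightarrow> ?D3"
      unfolding iff(2)[OF e] cancel rec by (simp add: algebra_simps)
    have 4: "((\<lambda>u. - (eps_star w \<kappa> \<phi>b n u / w u)) has_field_derivative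
        1 / W z * (- (c * z * \<Theta>s n z) * (eps w \<kappa> \<phi> n z / w z)
          + (\<Omega>s n z - V z - a * \<Theta>s n z) * - (eps_star w \<kappa> \<phi>b n z / w z))) (at z)
      \<longleftrightarrow> ?D4"
      unfolding neg iff(2)[OF es] mult_minus_right[of "W z * w z"] cancel rec by (simp add: algebra_simps)
    show ?thesis
      unfolding Ymat_def[abs_def] Amat_def scaled_mult_2x2 has_mat_derivative_2x2
        a_def[symmetric] b_def[symmetric] c_def[symmetric]
      by (simp only: 1 2 3 4 conj_ac)
  qed
qed

end
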